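(* Let $G$ be a connected graph. If the complement $\overline{G}$ is connected and $\mathrm{diam}(\overline{G})\geq 4$, then $rc(G)\leq 4$.
   Context: All graphs are finite, undirected and simple. For an edge-coloring $c:E(H)\to\{1,\dots,k\}$ (adjacent edges may receive the same color), a path is rainbow if no two of its edges have the same color; $H$ is rainbow connected under $c$ if every two vertices are joined by a rainbow path. The rainbow connection number $rc(H)$ of a nontrivial connected graph $H$ is the minimum $k$ for which such a coloring with $k$ colors exists. $\mathrm{diam}$ denotes diameter and $\overline{G}$ the complement of $G$. *)

theory Defs
  imports "Graph_Theory.Graph_Theory"
begin

text \<open>
  A finite simple undirected graph is a \<^locale>\<open>pair_graph\<close>: a finite digraph whose arc set is a
  symmetric irreflexive relation.  Its undirected edge between \<open>u\<close> and \<open>v\<close> is the set \<open>{u, v}\<close>, so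
  that both arcs of an edge carry the same color under a coloring \<open>c :: 'a set \<Rightarrow> nat\<close>.
\<close>

definition complement :: "'a pair_pre_digraph \<Rightarrow> 'a pair_pre_digraph" where
  "complement G = \<lparr> pverts = pverts G,
     parcs = {(u, v). u \<in> pverts G \<and> v \<in> pverts G \<and> u \<noteq> v \<and> (u, v) \<notin> parcs G} \<rparr>"

definition distance :: "'a pair_pre_digraph \<Rightarrow> 'a \<Rightarrow> 'a \<Rightarrow> ereal" where
  "distance G u v = wf_digraph.\<mu> (with_proj G) (\<lambda>_. 1) u v"

definition diam :: "'a pair_pre_digraph \<Rightarrow> ereal" where
  "diam G = (SUP u\<in>pverts G. SUP v\<in>pverts G. distance G u v)"

definition edge_of :: "'a \<times> 'a \<Rightarrow> 'a set" where
  "edge_of a = {fst a, snd a}"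

definition edges :: "'a pair_pre_digraph \<Rightarrow> 'a set set" where
  "edges G = edge_of ` parcs G"

definition edge_coloring :: "'a pair_pre_digraph \<Rightarrow> nat \<Rightarrow> ('a set \<Rightarrow> nat) \<Rightarrow> bool" where
  "edge_coloring G k c \<longleftrightarrow> c ` edges G \<subseteq> {1..k}"

text \<open>
  The arcs of a path belong to pairwise different edges, so comparing colors by position in the
  list is the same as comparing the colors of any two edges of the path.
\<close>

definition rainbow_path ::
  "'a pair_pre_digraph \<Rightarrow> ('a set \<Rightarrow> nat) \<Rightarrow> 'a \<Rightarrow> ('a \<times> 'a) list \<Rightarrow> 'a \<Rightarrow> bool" where
  "rainbow_path G c u p v \<longleftrightarrow>
     pre_digraph.apath (with_proj G) u p v \<and> distinct (map (\<lambda>a. c (edge_of a)) p)"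

definition rainbow_connected :: "'a pair_pre_digraph \<Rightarrow> ('a set \<Rightarrow> nat) \<Rightarrow> bool" where
  "rainbow_connected G c \<longleftrightarrow> (\<forall>u\<in>pverts G. \<forall>v\<in>pverts G. \<exists>p. rainbow_path G c u p v)"

definition rc :: "'a pair_pre_digraph \<Rightarrow> nat" where
  "rc G = (LEAST k. \<exists>c. edge_coloring G k c \<and> rainbow_connected G c)"

lemma pair_graph_complement:
  assumes "pair_graph G"
  shows "pair_graph (complement G)"
proof -
  interpret pair_graph G by fact
  have sub: "parcs (complement G) \<subseteq> pverts G \<times> pverts G"
    by (auto simp: complement_def)
  have "finite (parcs (complement G))"
    using finite_subset[OF sub] pair_finite_verts by simp
  moreover have "symmetric (with_proj (complement G))"
    using sym_arcs by (auto simp: symmetric_def complement_def intro!: symI dest: symD)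
  ultimately show ?thesis
    using pair_finite_verts by unfold_locales (auto simp: complement_def)
qed

lemma distinct_edges_apath:
  assumes "pcas u p v" "distinct (pawalk_verts u p)"
  shows "distinct (map edge_of p)"
proof -
  have verts: "\<Union> (edge_of ` set p) \<subseteq> set (pawalk_verts u p)"
    if "pcas u p v" for u :: 'a and p v
    using that
  proof (induction p arbitrary: u)
    case (Cons a p)
    have "snd a \<in> set (pawalk_verts (snd a) p)" by (cases p) (use Cons.prems in auto)
    then show ?case using Cons by (auto simp: edge_of_def)
  qed simp
  show ?thesis using assms
  proof (induction p arbitrary: u)
    case (Cons a p)
    have "fst a \<notin> \<Union> (edge_of ` set p)"
      using Cons.prems verts[of "snd a" p v] by auto
    then have "edge_of a \<notin> edge_of ` set p" by (auto simp: edge_of_def)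
    then show ?case using Cons by auto
  qed simp
qed

text \<open>The minimum defining \<^const>\<open>rc\<close> exists for connected graphs.\<close>

lemma rc_attained:
  assumes "pair_graph G" "Digraph_Component.connected (with_proj G)"
  shows "\<exists>c. edge_coloring G (rc G) c \<and> rainbow_connected G c"
proof -
  interpret pair_graph G by fact
  have "finite (edges G)" by (simp add: edges_def pair_finite_arcs)
  then obtain c where c: "bij_betw c (edges G) {1..card (edges G)}"
    using finite_same_card_bij[of "edges G" "{1..card (edges G)}"] by auto
  have "rainbow_connected G c"
    unfolding rainbow_connected_def
  proof (intro ballI)
    fix u v assume uv: "u \<in> pverts G" "v \<in> pverts G"
    have ms: "mk_symmetric (with_proj G) = G"
      using sym_arcs
      by (intro pair_pre_digraph.equality) (auto simp: mk_symmetric_def symmetric_def dest: symD)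
    have "u \<rightarrow>\<^sup>*\<^bsub>with_proj G\<^esub> v"
      using assms(2) uv unfolding Digraph_Component.connected_def ms
      by (auto simp: strongly_connected_def)
    then obtain p where p: "apath u p v" using reachable_apath by blast
    then have "distinct (map edge_of p)" "edge_of ` set p \<subseteq> edges G"
      using distinct_edges_apath[of u p v] by (auto simp: apath_def awalk_def edges_def)
    then have "distinct (map c (map edge_of p))"
      using c by (subst distinct_map) (auto simp: bij_betw_def intro: inj_on_subset)
    then show "\<exists>p. rainbow_path G c u p v"
      using p by (auto simp: rainbow_path_def comp_def)
  qed
  moreover have "edge_coloring G (card (edges G)) c"
    using c by (simp add: edge_coloring_def bij_betw_def)
  ultimately have "\<exists>k. \<exists>c. edge_coloring G k c \<and> rainbow_connected G c" by blast
  then show ?thesis unfolding rc_def by (rule LeastI_ex)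
qed

end

theory Submission
  imports Defs
begin

text \<open>
  Let \<open>x\<close> be a vertex of eccentricity at least 4 in the complement, and let \<open>L\<^sub>0 = {x}\<close>, \<open>L\<^sub>1\<close>, \<open>L\<^sub>2\<close>,
  \<open>L\<^sub>3\<close> and \<open>L\<^sub>4\<close> be the sets of vertices at complement distance 0, 1, 2, 3 and at least 4 from \<open>x\<close>.
  All five are nonempty, and in \<open>G\<close> two levels whose indices differ by at least 2 are completely
  joined.  Color the joins \<open>L\<^sub>1L\<^sub>3\<close>, \<open>L\<^sub>3L\<^sub>0\<close>, \<open>L\<^sub>0L\<^sub>4\<close>, \<open>L\<^sub>4L\<^sub>1\<close> with 1, 2, 3, 4, the join \<open>L\<^sub>2L\<^sub>4\<close> with 1 and
  the join \<open>L\<^sub>0L\<^sub>2\<close> with 4.  The 4-cycle \<open>L\<^sub>1L\<^sub>3L\<^sub>0L\<^sub>4\<close> and the triangle \<open>L\<^sub>0L\<^sub>2L\<^sub>4\<close> are then rainbow, so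
  running once around one of them joins any two vertices of the same level, and consecutive levels
  are joined by rainbow paths of length 2.
\<close>

text \<open>The default 1 covers the joins of levels 1, 3 and of levels 2, 4. It also falls on edges
  within a level or between consecutive levels, which the constructed paths avoid.\<close>

definition level_color :: "('a \<Rightarrow> nat) \<Rightarrow> 'a set \<Rightarrow> nat" where
  "level_color l e =
     (if l ` e = {0, 3} then 2 else if l ` e = {0, 4} then 3
      else if l ` e = {1, 4} \<or> l ` e = {0, 2} then 4 else 1)"

lemma rainbow_path_Nil:
  assumes "pair_graph G" "u \<in> pverts G"
  shows "rainbow_path G c u [] u"
proof -
  interpret pair_graph G by fact
  show ?thesis using assms(2)
    by (simp add: rainbow_path_def apath_def awalk_def)
qed

lemma rainbow_path_Cons:
  assumes "pair_graph G" "rainbow_path G c w p v" "(u, w) \<in> parcs G"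
    and "u \<notin> set (pawalk_verts w p)" "c {u, w} \<notin> (\<lambda>a. c (edge_of a)) ` set p"
  shows "rainbow_path G c u ((u, w) # p) v"
proof -
  interpret pair_graph G by fact
  show ?thesis using assms(2-)
    by (auto simp: rainbow_path_def apath_Cons_iff edge_of_def)
qed

lemma rainbow_path_edge:
  assumes "pair_graph G" "(u, v) \<in> parcs G"
  shows "rainbow_path G c u [(u, v)] v"
proof -
  interpret pair_graph G by fact
  show ?thesis
    using assms wellformed[of "(u, v)"] no_loops[of "(u, v)"]
    by (intro rainbow_path_Cons rainbow_path_Nil) auto
qed

text \<open>Links the \<open>ereal\<close> distance behind \<open>diam\<close> to relation powers,
  in which the levels are defined: a chain of \<open>n\<close> arcs is a walk of cost
  \<open>n\<close>.\<close>

lemma relpow_imp_distance_le: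
  assumes "pair_graph G" "u \<in> pverts G" "(u, v) \<in> parcs G ^^ n"
  shows "distance G u v \<le> ereal (real n)"
proof -
  interpret pair_graph G by fact
  have "\<exists>p. awalk u p v \<and> length p = n" using assms(2,3)
  proof (induction n arbitrary: v)
    case 0
    then show ?case by (auto simp: awalk_Nil_iff)
  next
    case (Suc n)
    then obtain w where "(u, w) \<in> parcs G ^^ n" "(w, v) \<in> parcs G" by auto
    moreover from this obtain p where "awalk u p w" "length p = n"
      using Suc.IH Suc.prems(1) by blast
    moreover have "awalk w [(w, v)] v"
      using \<open>(w, v) \<in> parcs G\<close> wellformed[of "(w, v)"] by (auto simp: awalk_def)
    ultimately show ?case by (intro exI[of _ "p @ [(w, v)]"]) (auto intro: awalk_appendI)
  qed
  then obtain p where p: "awalk u p v" "length p = n" by blast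
  have "awalk_cost (\<lambda>_. 1) p = real n"
    using p(2) by (simp add: awalk_cost_def sum_list_triv)
  then show ?thesis
    using min_cost_le_walk_cost[OF p(1), of "\<lambda>_. 1"] by (simp add: distance_def)
qed

lemma rc_le_4_if_levels:
  fixes l :: "'a \<Rightarrow> nat"
  assumes "pair_graph G"
    and le: "\<And>v. v \<in> pverts G \<Longrightarrow> l v \<le> 4"
    and ex: "\<And>k. k \<le> 4 \<Longrightarrow> \<exists>v\<in>pverts G. l v = k"
    and uniq: "\<And>u v. u \<in> pverts G \<Longrightarrow> v \<in> pverts G \<Longrightarrow> l u = 0 \<Longrightarrow> l v = 0 \<Longrightarrow> u = v"
    and join: "\<And>u v. u \<in> pverts G \<Longrightarrow> v \<in> pverts G \<Longrightarrow> l u + 2 \<le> l v \<Longrightarrow>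
                (u, v) \<in> parcs G \<and> (v, u) \<in> parcs G"
  shows "rc G \<le> 4"
proof -
  interpret pair_graph G by fact
  let ?c = "level_color l"
  \<comment> \<open>One representative per level; these are the inner vertices of all paths
    below.\<close>
  obtain z where z: "z k \<in> pverts G" "l (z k) = k" if "k \<le> 4" for k
    using ex by metis
  note Nil = rainbow_path_Nil[OF assms(1)] and Cons = rainbow_path_Cons[OF assms(1)]
  have path: "\<exists>p. rainbow_path G ?c u p v" if uv: "u \<in> pverts G" "v \<in> pverts G" for u v
  proof -
    have two: ?thesis if "(u, a) \<in> parcs G" "(a, v) \<in> parcs G" "u \<noteq> v" "u \<noteq> a" "a \<noteq> v"
      "?c {u, a} \<noteq> ?c {a, v}" for a
      using that uv by (intro exI[of _ "[(u, a), (a, v)]"] Cons Nil) (auto simp: edge_of_def)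
    have three: ?thesis if "(u, a) \<in> parcs G" "(a, b) \<in> parcs G" "(b, v) \<in> parcs G"
      "distinct [u, a, b, v]" "distinct [?c {u, a}, ?c {a, b}, ?c {b, v}]" for a b
      using that uv by (intro exI[of _ "[(u, a), (a, b), (b, v)]"] Cons Nil) (auto simp: edge_of_def)
    have four: ?thesis if "(u, a) \<in> parcs G" "(a, b) \<in> parcs G" "(b, d) \<in> parcs G"
      "(d, v) \<in> parcs G" "distinct [u, a, b, d, v]"
      "distinct [?c {u, a}, ?c {a, b}, ?c {b, d}, ?c {d, v}]" for a b d
      using that uv by (intro exI[of _ "[(u, a), (a, b), (b, d), (d, v)]"] Cons Nil) (auto simp: edge_of_def)
    have colors: "?c {a, b} = (if {l a, l b} = {0, 3} then 2 else if {l a, l b} = {0, 4} then 3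
      else if {l a, l b} = {1, 4} \<or> {l a, l b} = {0, 2} then 4 else 1)" for a b
      by (simp add: level_color_def)
    have arc: "(a, b) \<in> parcs G"
      if "a \<in> pverts G" "b \<in> pverts G" "l a + 2 \<le> l b \<or> l b + 2 \<le> l a" for a b
      using join that by blast
    have "l u \<in> {0, 1, 2, 3, 4}" "l v \<in> {0, 1, 2, 3, 4}"
      using le[OF uv(1)] le[OF uv(2)] by auto
    then consider "u = v" | "l u + 2 \<le> l v \<or> l v + 2 \<le> l u"
      | "l u = 0 \<and> l v = 1 \<or> l u = 1 \<and> l v = 0"
      | "l u = 1 \<and> l v = 2 \<or> l u = 2 \<and> l v = 1"
      | "l u = 2 \<and> l v = 3 \<or> l u = 3 \<and> l v = 2"
      | "l u = 3 \<and> l v = 4 \<or> l u = 4 \<and> l v = 3"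
      | "u \<noteq> v" "l u = 1" "l v = 1" | "u \<noteq> v" "l u = 2" "l v = 2"
      | "u \<noteq> v" "l u = 3" "l v = 3" | "u \<noteq> v" "l u = 4" "l v = 4"
      using uniq[OF uv] by (elim insertE emptyE) auto
    then show ?thesis
    proof cases
      case 1
      then show ?thesis using Nil uv by blast
    next
      case 2
      then show ?thesis using arc rainbow_path_edge[OF assms(1)] uv by blast
    next
      case 3
      \<comment> \<open>Consecutive levels pass through a level at distance at least 2 from both:
        colors 2, 1 here, then 4, 1, then 4, 2, then 2, 3, up to direction.\<close>
      then show ?thesis using uv z[of 3]
        by (intro two[of "z 3"] arc) (auto simp: colors doubleton_eq_iff)
    next
      case 4
      then show ?thesis using uv z[of 4]
        by (intro two[of "z 4"] arc) (auto simp: colors doubleton_eq_iff)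
    next
      case 5
      then show ?thesis using uv z[of 0]
        by (intro two[of "z 0"] arc) (auto simp: colors doubleton_eq_iff)
    next
      case 6
      then show ?thesis using uv z[of 0]
        by (intro two[of "z 0"] arc) (auto simp: colors doubleton_eq_iff)
    next
      case 7
      \<comment> \<open>Once around the 4-cycle of levels 1, 3, 0, 4: colors 1, 2, 3, 4.\<close>
      then show ?thesis using uv z[of 3] z[of 0] z[of 4]
        by (intro four[of "z 3" "z 0" "z 4"] arc) (auto simp: colors doubleton_eq_iff)
    next
      case 8
      \<comment> \<open>Once around the triangle of levels 2, 0, 4: colors 4, 3, 1.\<close>
      then show ?thesis using uv z[of 0] z[of 4]
        by (intro three[of "z 0" "z 4"] arc) (auto simp: colors doubleton_eq_iff)
    next
      case 9
      then show ?thesis using uv z[of 0] z[of 4] z[of 1]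
        by (intro four[of "z 0" "z 4" "z 1"] arc) (auto simp: colors doubleton_eq_iff)
    next
      case 10
      then show ?thesis using uv z[of 0] z[of 2]
        by (intro three[of "z 0" "z 2"] arc) (auto simp: colors doubleton_eq_iff)
    qed
  qed
  have "edge_coloring G 4 ?c"
    by (auto simp: edge_coloring_def level_color_def)
  moreover have "rainbow_connected G ?c"
    using path by (simp add: rainbow_connected_def)
  ultimately show ?thesis
    unfolding rc_def by (intro Least_le) blast
qed

theorem theorem3p3:
  fixes G :: "'a pair_pre_digraph"
  assumes "pair_graph G"
    and "Digraph_Component.connected (with_proj G)"
    and "Digraph_Component.connected (with_proj (complement G))"
    and "diam (complement G) \<ge> 4"
  shows "rc G \<le> 4"
proof -
  interpret pair_graph G by fact
  let ?H = "complement G"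
  let ?R = "parcs ?H"
  interpret H: pair_graph ?H using assms(1) by (rule pair_graph_complement)
  have verts: "pverts ?H = pverts G" by (simp add: complement_def)
  obtain x y where x: "x \<in> pverts G" and y: "y \<in> pverts G"
    and far: "\<And>n. (x, y) \<in> ?R ^^ n \<Longrightarrow> 4 \<le> n"
  proof (rule ccontr)
    \<comment> \<open>Otherwise any two vertices are at most 3 complement steps apart, which bounds
      the supremum \<open>diam ?H\<close> by 3.\<close>
    assume "\<not> thesis"
    with that have near: "\<forall>x\<in>pverts G. \<forall>y\<in>pverts G. \<exists>n<4. (x, y) \<in> ?R ^^ n"
      by (meson not_le)
    have "distance ?H u v \<le> 3" if "u \<in> pverts G" "v \<in> pverts G" for u v
    proof -
      obtain n where n: "n < 4" "(u, v) \<in> ?R ^^ n"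
        using near \<open>u \<in> pverts G\<close> \<open>v \<in> pverts G\<close> by blast
      have "distance ?H u v \<le> ereal (real n)"
        using relpow_imp_distance_le[OF H.pair_graph_axioms _ n(2)] \<open>u \<in> pverts G\<close> verts by simp
      also have "\<dots> \<le> ereal 3" using n(1) by simp
      finally show ?thesis by simp
    qed
    then have "diam ?H \<le> 3"
      unfolding diam_def verts by (intro SUP_least) auto
    with assms(4) have "(4::ereal) \<le> 3" by (rule order_trans)
    then show False by simp
  qed
  have reach: "\<exists>n. (x, v) \<in> ?R ^^ n" if v: "v \<in> pverts G" for v
  proof -
    have "x \<rightarrow>\<^sup>*\<^bsub>with_proj ?H\<^esub> v"
      using H.symmetric_connected_imp_strongly_connected[OF H.sym_arcs assms(3)] x v verts
      by (auto simp: strongly_connected_def)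
    then have "(x, v) \<in> ?R\<^sup>*"
      by (auto simp: reachable_def dest: rtrancl_on_rtranclI)
    then show ?thesis by (rule rtrancl_imp_relpow)
  qed
  define d where "d v = (LEAST n. (x, v) \<in> ?R ^^ n)" for v
  have d_le: "d v \<le> n" if "(x, v) \<in> ?R ^^ n" for v n
    unfolding d_def using that by (rule Least_le)
  have d: "(x, v) \<in> ?R ^^ d v" if "v \<in> pverts G" for v
    unfolding d_def using reach[OF that] by (rule LeastI_ex)
  have d_step: "d v \<le> Suc (d u)" if "(u, v) \<in> ?R" for u v
  proof -
    have "u \<in> pverts G" using that by (auto simp: complement_def)
    from relpow_Suc_I[OF d[OF this] that] show ?thesis by (rule d_le)
  qed
  show ?thesis
  proof (rule rc_le_4_if_levels[where l = "\<lambda>v. min 4 (d v)"])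
    fix k :: nat assume "k \<le> 4"
    \<comment> \<open>Level \<open>k\<close> is met by the vertex \<open>w\<close> reached after
      \<open>k\<close> steps of a shortest walk from \<open>x\<close> to \<open>y\<close>; a shorter
      way to \<open>w\<close> would shorten that walk.\<close>
    define m where "m = d y - k"
    have "d y = k + m" using far[OF d[OF y]] \<open>k \<le> 4\<close> by (simp add: m_def)
    with d[OF y] obtain w where w: "(x, w) \<in> ?R ^^ k" "(w, y) \<in> ?R ^^ m"
      by (auto simp: relpow_add)
    have "w \<in> pverts G"
      using w(1) x by (cases k) (auto simp: complement_def)
    have "(x, y) \<in> ?R ^^ (d w + m)"
      using d[OF \<open>w \<in> pverts G\<close>] w(2) by (auto simp: relpow_add)
    then have "d w = k"
      using d_le[OF w(1)] d_le[of y "d w + m"] \<open>d y = k + m\<close> by simp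
    then show "\<exists>v\<in>pverts G. min 4 (d v) = k"
      using \<open>w \<in> pverts G\<close> \<open>k \<le> 4\<close> by (intro bexI[of _ w]) auto
  next
    fix u v assume "u \<in> pverts G" "v \<in> pverts G" "min 4 (d u) = 0" "min 4 (d v) = 0"
    then show "u = v" using d[of u] d[of v] by (simp add: min_def split: if_splits)
  next
    fix u v assume uv: "u \<in> pverts G" "v \<in> pverts G" "min 4 (d u) + 2 \<le> min 4 (d v)"
    \<comment> \<open>The truncated gap forces \<open>d u \<le> 2\<close>, so truncation leaves
      \<open>d u\<close> unchanged. A complement edge raises \<open>d\<close> by at most 1, hence
      \<open>u\<close> and \<open>v\<close> are adjacent in \<open>G\<close>.\<close>
    then have "d u + 2 \<le> d v" by linarith
    then have "(u, v) \<notin> ?R" "u \<noteq> v" using d_step[of u v] by auto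
    then have "(u, v) \<in> parcs G" using uv by (simp add: complement_def)
    then show "(u, v) \<in> parcs G \<and> (v, u) \<in> parcs G"
      using arcs_symmetric by auto
  qed (use assms(1) in auto)
qed

end
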